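(* Let $G$ be a primitive permutation group which is either of affine type, or of simple diagonal type with two simple factors in the socle. Then $G$ is synchronizing if and only if $G$ is separating.
   Context: All sets and groups are finite; permutations act on the right. A permutation group $G$ on $\Omega$ is called synchronizing if, for every map $t:\Omega\to\Omega$ which is not a permutation, the monoid $\langle G,t\rangle$ generated by $G$ and $t$ contains a map of rank $1$ (one whose image is a single point); otherwise it is non-synchronizing. A transitive permutation group $G$ on $\Omega$ is non-separating if there exist subsets $A,B\subseteq\Omega$ with $|A|,|B|>1$, $|A|\cdot|B|=|\Omega|$ and $|Ag\cap B|=1$ for all $g\in G$; otherwise it is separating. A permutation group is primitive if it is transitive and preserves no non-trivial partition of $\Omega$. A primitive group $G$ is of affine type if it is (up to permutation isomorphism) a group of mappings of the form $x\mapsto xM+b$ on a finite-dimensional vector space $V$ over a finite field of prime order, where $M$ is an invertible linear map and $b\in V$, and $G$ contains the translation subgroup $\{x\mapsto x+b: b\in V\}$, which is its socle. A primitive group $G$ is of simple diagonal type with two factors in the socle if, for some non-abelian finite simple group $T$, it is (up to permutation isomorphism) a permutation group on the set $T$ that contains all the permutations $x\mapsto g^{-1}xh$ with $g,h\in T$ (these form its socle, isomorphic to $T\times T$) and is contained in the group $D(T,2)$ generated by these permutations together with the automorphisms $x\mapsto x^\alpha$ ($\alpha\in\mathrm{Aut}(T)$) and the inversion map $x\mapsto x^{-1}$. *)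

theory Defs
  imports
    "HOL-Algebra.Algebra"
    "HOL-Library.Disjoint_Sets"
    "Jordan_Normal_Form.Missing_VectorSpace"
begin

text \<open>
  A permutation group on \<open>\<Omega>\<close> is a set \<open>G\<close> with \<^term>\<open>subgroup G (BijGroup \<Omega>)\<close>; its elements are
  extensional functions on \<open>\<Omega>\<close>. \<^const>\<open>BijGroup\<close> multiplies maps from right to left, whereas the
  mathematical convention here is that permutations act on the right. Passing between the two
  replaces a product by the opposite one, which changes neither the set of permutations nor which
  sets of maps are closed under products, so every notion below is the same in both conventions.
\<close>

definition transitive_group :: "'a set \<Rightarrow> ('a \<Rightarrow> 'a) set \<Rightarrow> bool" where
  "transitive_group \<Omega> G \<longleftrightarrow> transitive_action (BijGroup \<Omega>\<lparr>carrier := G\<rparr>) \<Omega> (\<lambda>g. g)"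

definition primitive_group :: "'a set \<Rightarrow> ('a \<Rightarrow> 'a) set \<Rightarrow> bool" where
  "primitive_group \<Omega> G \<longleftrightarrow>
     transitive_group \<Omega> G \<and>
     (\<forall>P. partition_on \<Omega> P \<and> (\<forall>g\<in>G. \<forall>B\<in>P. g ` B \<in> P) \<longrightarrow>
        P = {\<Omega>} \<or> P = (\<lambda>x. {x}) ` \<Omega>)"

definition transformation_monoid :: "'a set \<Rightarrow> ('a \<Rightarrow> 'a) monoid" where
  "transformation_monoid \<Omega> =
     \<lparr>carrier = \<Omega> \<rightarrow>\<^sub>E \<Omega>, monoid.mult = compose \<Omega>, one = (\<lambda>x\<in>\<Omega>. x)\<rparr>"

definition generated_monoid :: "'a set \<Rightarrow> ('a \<Rightarrow> 'a) set \<Rightarrow> ('a \<Rightarrow> 'a) set" where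
  "generated_monoid \<Omega> S = (\<lambda>M. submonoid M (transformation_monoid \<Omega>)) hull S"

definition synchronizing :: "'a set \<Rightarrow> ('a \<Rightarrow> 'a) set \<Rightarrow> bool" where
  "synchronizing \<Omega> G \<longleftrightarrow>
     (\<forall>t \<in> \<Omega> \<rightarrow>\<^sub>E \<Omega>. t \<notin> Bij \<Omega> \<longrightarrow>
        (\<exists>s \<in> generated_monoid \<Omega> (insert t G). card (s ` \<Omega>) = 1))"

definition non_separating :: "'a set \<Rightarrow> ('a \<Rightarrow> 'a) set \<Rightarrow> bool" where
  "non_separating \<Omega> G \<longleftrightarrow>
     transitive_group \<Omega> G \<and>
     (\<exists>A B. A \<subseteq> \<Omega> \<and> B \<subseteq> \<Omega> \<and> card A > 1 \<and> card B > 1 \<and> card A * card B = card \<Omega> \<and>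
        (\<forall>g\<in>G. card (g ` A \<inter> B) = 1))"

definition separating :: "'a set \<Rightarrow> ('a \<Rightarrow> 'a) set \<Rightarrow> bool" where
  "separating \<Omega> G \<longleftrightarrow> transitive_group \<Omega> G \<and> \<not> non_separating \<Omega> G"

definition perm_isomorphic ::
    "'a set \<Rightarrow> ('a \<Rightarrow> 'a) set \<Rightarrow> 'b set \<Rightarrow> ('b \<Rightarrow> 'b) set \<Rightarrow> bool" where
  "perm_isomorphic \<Omega> G \<Delta> H \<longleftrightarrow>
     (\<exists>\<phi> \<psi>. bij_betw \<phi> \<Omega> \<Delta> \<and>
        \<psi> \<in> iso (BijGroup \<Omega>\<lparr>carrier := G\<rparr>) (BijGroup \<Delta>\<lparr>carrier := H\<rparr>) \<and>
        (\<forall>g\<in>G. \<forall>x\<in>\<Omega>. \<phi> (g x) = \<psi> g (\<phi> x)))"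

text \<open>
  The translation subgroup of a primitive affine group is automatically its socle, and so is the
  subgroup of all maps \<open>x \<mapsto> g\<^sup>-\<^sup>1 x h\<close> of a diagonal group; neither is imposed as a condition.
\<close>

definition affine_map :: "('v, 'm) ring_scheme \<Rightarrow> ('v \<Rightarrow> 'v) \<Rightarrow> 'v \<Rightarrow> 'v \<Rightarrow> 'v" where
  "affine_map V f b = (\<lambda>x\<in>carrier V. f x \<oplus>\<^bsub>V\<^esub> b)"

definition affine_group :: "'k ring \<Rightarrow> ('k, 'v) module \<Rightarrow> ('v \<Rightarrow> 'v) set \<Rightarrow> bool" where
  "affine_group K V H \<longleftrightarrow>
     subgroup H (BijGroup (carrier V)) \<and>
     H \<subseteq> {affine_map V f b | f b.
           linear_map K V V f \<and> bij_betw f (carrier V) (carrier V) \<and> b \<in> carrier V} \<and>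
     {affine_map V (\<lambda>x. x) b | b. b \<in> carrier V} \<subseteq> H"

definition affine_type ::
    "'k ring \<Rightarrow> ('k, 'v) module \<Rightarrow> 'a set \<Rightarrow> ('a \<Rightarrow> 'a) set \<Rightarrow> bool" where
  "affine_type K V \<Omega> G \<longleftrightarrow>
     vectorspace K V \<and> Factorial_Ring.prime (order K) \<and> vectorspace.fin_dim K V \<and>
     (\<exists>H. affine_group K V H \<and> perm_isomorphic \<Omega> G (carrier V) H)"

definition diagonal_socle :: "'t monoid \<Rightarrow> ('t \<Rightarrow> 't) set" where
  "diagonal_socle T =
     {(\<lambda>x\<in>carrier T. inv\<^bsub>T\<^esub> g \<otimes>\<^bsub>T\<^esub> x \<otimes>\<^bsub>T\<^esub> h) | g h. g \<in> carrier T \<and> h \<in> carrier T}"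

text \<open>The group \<open>D(T,2)\<close>; \<^term>\<open>auto T\<close> is the set of automorphisms of \<open>T\<close>.\<close>

definition full_diagonal_group :: "'t monoid \<Rightarrow> ('t \<Rightarrow> 't) set" where
  "full_diagonal_group T =
     generate (BijGroup (carrier T))
       (diagonal_socle T \<union> auto T \<union> {\<lambda>x\<in>carrier T. inv\<^bsub>T\<^esub> x})"

definition diagonal_type :: "'t monoid \<Rightarrow> 'a set \<Rightarrow> ('a \<Rightarrow> 'a) set \<Rightarrow> bool" where
  "diagonal_type T \<Omega> G \<longleftrightarrow>
     simple_group T \<and> finite (carrier T) \<and> \<not> comm_group T \<and>
     (\<exists>H. subgroup H (BijGroup (carrier T)) \<and>
        diagonal_socle T \<subseteq> H \<and> H \<subseteq> full_diagonal_group T \<and>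
        perm_isomorphic \<Omega> G (carrier T) H)"

end

theory Submission
  imports Defs
begin

text \<open>
  For a transitive group, an element \<open>s\<close> of minimal rank in a monoid \<open>\<langle>G, t\<rangle>\<close> without constant
  maps yields the pair consisting of the image of \<open>s\<close> and a kernel class of \<open>s\<close>; double counting
  shows that the product of their sizes is \<open>|\<Omega>|\<close>, so \<open>G\<close> is non-separating.

  Conversely, both an affine group and a diagonal group with two socle factors act on a set that
  carries a group structure whose left and right translations all lie in \<open>G\<close>. If \<open>|Ag \<inter> B| = 1\<close>
  for all \<open>g \<in> G\<close>, then the right translations show that the sets \<open>a\<inverse>B\<close> with \<open>a \<in> A\<close>
  partition \<open>\<Omega>\<close>, and the left translations show that every \<open>Ag\<close> is a transversal of this
  partition. The map \<open>t\<close> sending \<open>a\<inverse>B\<close> to \<open>a\<close> is therefore not synchronized by \<open>G\<close>: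
  every element of \<open>\<langle>G, t\<rangle>\<close> maps \<open>G\<close>-translates of \<open>A\<close> onto \<open>G\<close>-translates of \<open>A\<close>.
\<close>

section \<open>Submonoids generated by transformations\<close>

text \<open>The hypothesis puts the full transformation monoid among the submonoids containing
  \<open>S\<close>. Without such a submonoid the hull would be an empty intersection, hence
  \<open>UNIV\<close>.\<close>

lemma submonoid_generated_monoid:
  assumes "S \<subseteq> \<Omega> \<rightarrow>\<^sub>E \<Omega>"
  shows "submonoid (generated_monoid \<Omega> S) (transformation_monoid \<Omega>)"
proof -
  have top: "submonoid (\<Omega> \<rightarrow>\<^sub>E \<Omega>) (transformation_monoid \<Omega>)"
    by unfold_locales (auto simp: transformation_monoid_def compose_def)
  show ?thesis
  proof
    show "generated_monoid \<Omega> S \<subseteq> carrier (transformation_monoid \<Omega>)"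
      using hull_minimal[of S "\<Omega> \<rightarrow>\<^sub>E \<Omega>" "\<lambda>M. submonoid M (transformation_monoid \<Omega>)"] assms top
      by (auto simp: generated_monoid_def transformation_monoid_def)
  qed (auto simp: generated_monoid_def hull_def dest: submonoid.m_closed submonoid.one_closed)
qed

text \<open>The transformations satisfying \<open>P\<close> form a submonoid containing
  \<open>S\<close>, so minimality of the hull applies.\<close>

lemma generated_monoid_induct:
  assumes "s \<in> generated_monoid \<Omega> S"
    and "S \<subseteq> \<Omega> \<rightarrow>\<^sub>E \<Omega>"
    and "\<And>f. f \<in> S \<Longrightarrow> P f"
    and "P (\<lambda>x\<in>\<Omega>. x)"
    and "\<And>f g. \<lbrakk>f \<in> \<Omega> \<rightarrow>\<^sub>E \<Omega>; g \<in> \<Omega> \<rightarrow>\<^sub>E \<Omega>; P f; P g\<rbrakk> \<Longrightarrow> P (compose \<Omega> f g)"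
  shows "P s"
proof -
  have "submonoid {f \<in> \<Omega> \<rightarrow>\<^sub>E \<Omega>. P f} (transformation_monoid \<Omega>)"
    using assms(4,5) by unfold_locales (auto simp: transformation_monoid_def compose_def)
  then have "generated_monoid \<Omega> S \<subseteq> {f \<in> \<Omega> \<rightarrow>\<^sub>E \<Omega>. P f}"
    unfolding generated_monoid_def using assms(2,3) by (intro hull_minimal) auto
  with assms(1) show ?thesis by auto
qed

section \<open>Finite permutation groups and double counting\<close>

locale perm_group =
  fixes \<Omega> :: "'a set" and G :: "('a \<Rightarrow> 'a) set"
  assumes finite_domain: "finite \<Omega>"
    and subgroup_BijGroup: "subgroup G (BijGroup \<Omega>)"
begin

lemma perm_Bij: "g \<in> G \<Longrightarrow> g \<in> Bij \<Omega>"
  using subgroup.subset[OF subgroup_BijGroup] by (auto simp: BijGroup_def)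

lemma perm_bij_betw: "g \<in> G \<Longrightarrow> bij_betw g \<Omega> \<Omega>"
  using perm_Bij by (auto simp: Bij_def)

lemma perm_in: "g \<in> G \<Longrightarrow> x \<in> \<Omega> \<Longrightarrow> g x \<in> \<Omega>"
  using perm_bij_betw by (auto simp: bij_betw_def)

lemma perm_inj_on: "g \<in> G \<Longrightarrow> A \<subseteq> \<Omega> \<Longrightarrow> inj_on g A"
  using perm_bij_betw by (auto simp: bij_betw_def intro: inj_on_subset)

lemma perm_PiE: "G \<subseteq> \<Omega> \<rightarrow>\<^sub>E \<Omega>"
proof
  fix g assume "g \<in> G"
  then show "g \<in> \<Omega> \<rightarrow>\<^sub>E \<Omega>"
    using perm_Bij[of g] perm_in[of g] by (auto simp: Bij_def PiE_iff)
qed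

lemma perm_compose: "g \<in> G \<Longrightarrow> h \<in> G \<Longrightarrow> compose \<Omega> g h \<in> G"
  using subgroup.m_closed[OF subgroup_BijGroup, of g h] perm_Bij by (simp add: BijGroup_def)

lemma one_perm: "(\<lambda>x\<in>\<Omega>. x) \<in> G"
  using subgroup.one_closed[OF subgroup_BijGroup] by (simp add: BijGroup_def)

lemma finite_group: "finite G"
  using finite_subset[OF perm_PiE] finite_domain by (simp add: finite_PiE)

lemma image_compose: "A \<subseteq> \<Omega> \<Longrightarrow> compose \<Omega> g h ` A = g ` h ` A"
  by (force simp: compose_def)

lemma transitiveD:
  assumes "transitive_group \<Omega> G" "x \<in> \<Omega>" "y \<in> \<Omega>"
  shows "\<exists>g\<in>G. g x = y"
  using transitive_action.unique_orbit[OF assms(1)[unfolded transitive_group_def] assms(2,3)]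
  by auto

text \<open>Orbit-stabiliser without cosets: composing with some \<open>h\<close> that takes
  \<open>c\<close> to \<open>d\<close> injects the elements sending \<open>a\<close> to
  \<open>c\<close> into those sending \<open>a\<close> to \<open>d\<close>. By symmetry all these
  sets have the same size, and they partition \<open>G\<close>.\<close>

lemma card_transporter:
  assumes "transitive_group \<Omega> G" "a \<in> \<Omega>" "b \<in> \<Omega>"
  shows "card \<Omega> * card {g \<in> G. g a = b} = card G"
proof -
  have le: "card {g \<in> G. g a = c} \<le> card {g \<in> G. g a = d}" if "c \<in> \<Omega>" "d \<in> \<Omega>" for c d
  proof -
    obtain h where h: "h \<in> G" "h c = d"
      using transitiveD[OF assms(1) \<open>c \<in> \<Omega>\<close> \<open>d \<in> \<Omega>\<close>] by blast
    have "inj_on (compose \<Omega> h) {g \<in> G. g a = c}"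
    proof (rule inj_onI)
      fix f g assume fg: "f \<in> {g \<in> G. g a = c}" "g \<in> {g \<in> G. g a = c}"
        "compose \<Omega> h f = compose \<Omega> h g"
      then have "f \<in> \<Omega> \<rightarrow>\<^sub>E \<Omega>" "g \<in> \<Omega> \<rightarrow>\<^sub>E \<Omega>"
        using perm_PiE by auto
      moreover have "f x = g x" if "x \<in> \<Omega>" for x
        using that fg(1,2) fun_cong[OF fg(3), of x] perm_inj_on[OF h(1) order.refl] perm_in
        by (auto simp: compose_def dest: inj_onD)
      ultimately show "f = g"
        by (rule PiE_ext)
    qed
    moreover have "compose \<Omega> h ` {g \<in> G. g a = c} \<subseteq> {g \<in> G. g a = d}"
      using h assms(2) perm_compose by (auto simp: compose_def)
    ultimately show ?thesis
      using finite_group by (intro card_inj_on_le) auto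
  qed
  have "card (\<Union>c\<in>\<Omega>. {g \<in> G. g a = c}) = (\<Sum>c\<in>\<Omega>. card {g \<in> G. g a = c})"
    using finite_group finite_domain by (intro card_UN_disjoint) auto
  moreover have "(\<Union>c\<in>\<Omega>. {g \<in> G. g a = c}) = G"
    using perm_in assms(2) by auto
  ultimately have "card G = (\<Sum>c\<in>\<Omega>. card {g \<in> G. g a = c})"
    by simp
  also have "\<dots> = (\<Sum>c\<in>\<Omega>. card {g \<in> G. g a = b})"
    using le assms(3) by (intro sum.cong refl antisym) auto
  finally show ?thesis by simp
qed

text \<open>Count the triples \<open>(g, a, b)\<close> with \<open>g a = b\<close> in two orders.
  Each pair \<open>(a, b)\<close> occurs for a fraction \<open>1 / card \<Omega>\<close> of
  \<open>G\<close>; the factor \<open>card \<Omega>\<close> avoids the division.\<close>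

lemma sum_card_image_Int:
  assumes "transitive_group \<Omega> G" "A \<subseteq> \<Omega>" "B \<subseteq> \<Omega>"
  shows "card \<Omega> * (\<Sum>g\<in>G. card (g ` A \<inter> B)) = card A * card B * card G"
proof -
  have fin: "finite A" "finite B"
    using assms finite_domain by (auto intro: finite_subset)
  have "card (g ` A \<inter> B) = (\<Sum>a\<in>A. \<Sum>b\<in>B. if g a = b then 1 else 0)" if "g \<in> G" for g
  proof -
    have "g ` A \<inter> B = g ` {a \<in> A. g a \<in> B}" by auto
    then have "card (g ` A \<inter> B) = card {a \<in> A. g a \<in> B}"
      using assms(2) by (auto intro: card_image perm_inj_on[OF that])
    also have "\<dots> = (\<Sum>a\<in>A. if g a \<in> B then 1 else 0)"
      using fin(1) by (simp add: sum.If_cases Int_def)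
    finally show ?thesis using fin(2) by simp
  qed
  then have "(\<Sum>g\<in>G. card (g ` A \<inter> B)) = (\<Sum>g\<in>G. \<Sum>a\<in>A. \<Sum>b\<in>B. if g a = b then 1 else 0)"
    by simp
  also have "\<dots> = (\<Sum>a\<in>A. \<Sum>b\<in>B. \<Sum>g\<in>G. if g a = b then 1 else 0)"
    by (subst sum.swap, intro sum.cong refl sum.swap)
  also have "\<dots> = (\<Sum>a\<in>A. \<Sum>b\<in>B. card {g \<in> G. g a = b})"
    using finite_group by (simp add: sum.If_cases Int_def)
  finally have "card \<Omega> * (\<Sum>g\<in>G. card (g ` A \<inter> B)) =
      (\<Sum>a\<in>A. \<Sum>b\<in>B. card \<Omega> * card {g \<in> G. g a = b})"
    by (simp add: sum_distrib_left)
  also have "\<dots> = (\<Sum>a\<in>A. \<Sum>b\<in>B. card G)"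
    using assms by (intro sum.cong refl card_transporter) auto
  finally show ?thesis by simp
qed

section \<open>Separating groups are synchronizing\<close>

lemma synchronizing_if_separating:
  assumes "separating \<Omega> G"
  shows "synchronizing \<Omega> G"
  unfolding synchronizing_def
proof (intro ballI impI, rule ccontr)
  fix t assume t: "t \<in> \<Omega> \<rightarrow>\<^sub>E \<Omega>" "t \<notin> Bij \<Omega>"
    and no_const: "\<not> (\<exists>s \<in> generated_monoid \<Omega> (insert t G). card (s ` \<Omega>) = 1)"
  define M where "M = generated_monoid \<Omega> (insert t G)"
  have trans: "transitive_group \<Omega> G"
    using assms by (simp add: separating_def)
  have M: "submonoid M (transformation_monoid \<Omega>)"
    unfolding M_def using t(1) perm_PiE by (intro submonoid_generated_monoid) auto
  have gens: "insert t G \<subseteq> M"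
    unfolding M_def generated_monoid_def by (rule hull_subset)
  have M_compose: "compose \<Omega> f g \<in> M" if "f \<in> M" "g \<in> M" for f g
    using submonoid.m_closed[OF M that] by (simp add: transformation_monoid_def)
  \<comment> \<open>The minimum exists because \<open>t\<close> lies in \<open>M\<close>.\<close>
  define s where "s = arg_min (\<lambda>s. card (s ` \<Omega>)) (\<lambda>s. s \<in> M)"
  have s: "s \<in> M" and s_min: "\<And>f. f \<in> M \<Longrightarrow> card (s ` \<Omega>) \<le> card (f ` \<Omega>)"
    using arg_min_natI[of "\<lambda>s. s \<in> M" t "\<lambda>s. card (s ` \<Omega>)"]
      arg_min_nat_le[of "\<lambda>s. s \<in> M" _ "\<lambda>s. card (s ` \<Omega>)"] gens
    unfolding s_def by auto
  define A where "A = s ` \<Omega>"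
  have A: "A \<subseteq> \<Omega>"
    using submonoid.subset[OF M] s by (auto simp: A_def transformation_monoid_def)
  have finA: "finite A" using A finite_domain by (rule finite_subset)
  \<comment> \<open>On a finite set a map of full rank is a permutation. The strict drop in rank
    later rules out \<open>card B = 1\<close>.\<close>
  have "card (t ` \<Omega>) \<noteq> card \<Omega>"
  proof
    assume "card (t ` \<Omega>) = card \<Omega>"
    moreover have "t ` \<Omega> \<subseteq> \<Omega>" using t(1) by auto
    ultimately have "t ` \<Omega> = \<Omega>" "inj_on t \<Omega>"
      using finite_domain card_subset_eq[of \<Omega> "t ` \<Omega>"] by (auto intro: eq_card_imp_inj_on)
    then show False using t by (auto simp: Bij_def bij_betw_def PiE_iff)
  qed
  then have "card (t ` \<Omega>) < card \<Omega>"
    using card_image_le[OF finite_domain, of t] by simp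
  then have A_less: "card A < card \<Omega>"
    using s_min[of t] gens by (simp add: A_def)
  \<comment> \<open>By \<open>A_less\<close> the domain is non-empty, and so is the image of
    \<open>s\<close>.\<close>
  have "card A \<noteq> 1" "card A \<noteq> 0"
    using no_const s A_less finite_domain by (auto simp: A_def M_def)
  then have A_gt: "card A > 1" by simp
  then obtain c where c: "c \<in> A" by fastforce
  define B where "B = {x \<in> \<Omega>. s x = c}"
  have B: "B \<subseteq> \<Omega>" by (auto simp: B_def)
  have one: "card (g ` A \<inter> B) = 1" if g: "g \<in> G" for g
  proof -
    have gA: "g ` A \<subseteq> \<Omega>" "finite (g ` A)" using A g perm_in finA by auto
    \<comment> \<open>The map \<open>s g s\<close> has image s(gA), which lies in \<open>A\<close>.
      Minimality of the rank forces s(gA) = A, so \<open>s\<close> is injective on gA and gA meets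
      the kernel class \<open>B\<close> exactly once.\<close>
    have "compose \<Omega> s (compose \<Omega> g s) ` \<Omega> = s ` g ` A"
      using A gA by (force simp: compose_def A_def)
    moreover have "compose \<Omega> s (compose \<Omega> g s) \<in> M"
      using M_compose s g gens by auto
    ultimately have "card A \<le> card (s ` g ` A)"
      using s_min by (metis A_def)
    moreover have sub: "s ` g ` A \<subseteq> A" using gA(1) by (auto simp: A_def)
    ultimately have eq: "s ` g ` A = A"
      using finA by (intro card_seteq) auto
    moreover have "card (g ` A) = card A"
      using perm_inj_on[OF g A] by (rule card_image)
    ultimately have inj: "inj_on s (g ` A)"
      using gA(2) by (intro eq_card_imp_inj_on) auto
    obtain y where y: "y \<in> g ` A" "s y = c" using eq c by (metis imageE)
    have "g ` A \<inter> B = {y}"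
      using y gA(1) inj by (auto simp: B_def dest: inj_onD)
    then show ?thesis by simp
  qed
  \<comment> \<open>Every summand in the double count equals 1; the factor \<open>card G\<close>
    then cancels because \<open>G\<close> contains the identity.\<close>
  have "card \<Omega> * card G = card A * card B * card G"
    using sum_card_image_Int[OF trans A B] one by simp
  moreover have "card G \<noteq> 0" using one_perm finite_group by auto
  ultimately have prod: "card A * card B = card \<Omega>" by simp
  with A_less have "card B > 1"
    by (cases "card B = 0 \<or> card B = 1") auto
  with A B A_gt prod one trans have "non_separating \<Omega> G"
    unfolding non_separating_def by blast
  with assms show False by (simp add: separating_def)
qed

section \<open>Synchronizing groups with two-sided translations are separating\<close>

text \<open>The common form of the affine and diagonal cases: \<phi> identifies the points with the
  elements of \<Gamma>. In \<open>two_sided\<close>, taking \<open>g\<close> trivial gives right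
  translations and taking \<open>h\<close> trivial gives left translations.\<close>

lemma separating_if_synchronizing:
  fixes \<Gamma> :: "('b, 'c) monoid_scheme"
  assumes "transitive_group \<Omega> G"
    and "group \<Gamma>" and \<phi>: "bij_betw \<phi> \<Omega> (carrier \<Gamma>)"
    and two_sided: "\<And>g h. \<lbrakk>g \<in> carrier \<Gamma>; h \<in> carrier \<Gamma>\<rbrakk> \<Longrightarrow>
      \<exists>p\<in>G. \<forall>x\<in>\<Omega>. \<phi> (p x) = inv\<^bsub>\<Gamma>\<^esub> g \<otimes>\<^bsub>\<Gamma>\<^esub> \<phi> x \<otimes>\<^bsub>\<Gamma>\<^esub> h"
    and sync: "synchronizing \<Omega> G"
  shows "separating \<Omega> G"
proof (rule ccontr)
  interpret \<Gamma>: group \<Gamma> by fact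
  assume "\<not> separating \<Omega> G"
  then obtain A B where A: "A \<subseteq> \<Omega>" "card A > 1" and B: "B \<subseteq> \<Omega>" "card B > 1"
    and prod: "card A * card B = card \<Omega>" and one: "\<And>g. g \<in> G \<Longrightarrow> card (g ` A \<inter> B) = 1"
    using assms(1) by (auto simp: separating_def non_separating_def)
  have \<phi>_in: "\<phi> x \<in> carrier \<Gamma>" if "x \<in> \<Omega>" for x
    using \<phi> that by (auto simp: bij_betw_def)
  have \<phi>_mem: "\<phi> x \<in> \<phi> ` B \<longleftrightarrow> x \<in> B" if "x \<in> \<Omega>" for x
    using inj_on_image_mem_iff[OF bij_betw_imp_inj_on[OF \<phi>] that B(1)] .
  \<comment> \<open>Right translation by \<open>\<phi> x\<close> moves \<open>A\<close> to a set
    meeting \<open>B\<close> once. Read in \<Gamma>, this says that \<open>x\<close> lies in the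
    block a^-1 B for exactly one \<open>a\<close>.\<close>
  have unique: "\<exists>!a. a \<in> A \<and> \<phi> a \<otimes>\<^bsub>\<Gamma>\<^esub> \<phi> x \<in> \<phi> ` B" if x: "x \<in> \<Omega>" for x
  proof -
    obtain p where p: "p \<in> G" "\<And>y. y \<in> \<Omega> \<Longrightarrow> \<phi> (p y) = \<phi> y \<otimes>\<^bsub>\<Gamma>\<^esub> \<phi> x"
      using two_sided[OF \<Gamma>.one_closed \<phi>_in[OF x]] \<phi>_in by auto
    then have iff: "\<phi> a \<otimes>\<^bsub>\<Gamma>\<^esub> \<phi> x \<in> \<phi> ` B \<longleftrightarrow> p a \<in> B" if "a \<in> A" for a
      using that A(1) \<phi>_mem[of "p a"] perm_in[OF p(1)] by (metis subsetD)
    obtain y where y: "p ` A \<inter> B = {y}"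
      using one[OF p(1)] by (auto simp: card_1_singleton_iff)
    then have "y \<in> p ` A \<inter> B" by simp
    then obtain a where a: "a \<in> A" "p a = y" "y \<in> B" by (metis IntE imageE)
    have "\<exists>!a. a \<in> A \<and> p a \<in> B"
    proof (rule ex1I[of _ a])
      fix a' assume "a' \<in> A \<and> p a' \<in> B"
      then have a': "a' \<in> A" "p a' \<in> p ` A \<inter> B" by auto
      then have "p a' = p a" unfolding y a(2) by simp
      then show "a' = a" by (rule inj_onD[OF perm_inj_on[OF p(1) A(1)] _ a'(1) a(1)])
    qed (use a in simp)
    then show ?thesis using iff by metis
  qed
  \<comment> \<open>\<open>t\<close> sends each point to the label of its block;
    \<open>unique\<close> makes the description definite.\<close>
  define t where "t = (\<lambda>x\<in>\<Omega>. THE a. a \<in> A \<and> \<phi> a \<otimes>\<^bsub>\<Gamma>\<^esub> \<phi> x \<in> \<phi> ` B)"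
  have t_in: "t x \<in> A" if "x \<in> \<Omega>" for x
    using theI'[OF unique[OF that]] that by (simp add: t_def)
  have t_eq: "t x = a" if "x \<in> \<Omega>" "a \<in> A" "\<phi> a \<otimes>\<^bsub>\<Gamma>\<^esub> \<phi> x \<in> \<phi> ` B" for x a
    using the1_equality[OF unique[OF that(1)]] that by (simp add: t_def)
  have t_PiE: "t \<in> \<Omega> \<rightarrow>\<^sub>E \<Omega>"
    using t_in A(1) by (auto simp: t_def PiE_iff)
  have t_image: "t ` g ` A = A" if g: "g \<in> G" for g
  proof
    show "t ` g ` A \<subseteq> A" using t_in perm_in[OF g] A(1) by auto
    show "A \<subseteq> t ` g ` A"
    proof
      fix a assume a: "a \<in> A"
      then have a': "\<phi> a \<in> carrier \<Gamma>" using A(1) \<phi>_in by auto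
      \<comment> \<open>Left translation by \<open>\<phi> a\<close>, obtained from the inverse of
        \<open>\<phi> a\<close>, carries the block a^-1 B onto \<open>B\<close>. So a point of p(gA)
        in \<open>B\<close> comes from a point of gA in the block labelled \<open>a\<close>.\<close>
      obtain p where p: "p \<in> G" "\<And>y. y \<in> \<Omega> \<Longrightarrow> \<phi> (p y) = \<phi> a \<otimes>\<^bsub>\<Gamma>\<^esub> \<phi> y"
        using two_sided[OF \<Gamma>.inv_closed[OF a'] \<Gamma>.one_closed] \<phi>_in a' by auto
      have "card (p ` g ` A \<inter> B) = 1"
        using one[OF perm_compose[OF p(1) g]] unfolding image_compose[OF A(1)] .
      then have "p ` g ` A \<inter> B \<noteq> {}" by (metis card.empty zero_neq_one)
      then obtain y where y: "y \<in> g ` A" "p y \<in> B" by blast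
      then have "y \<in> \<Omega>" using perm_in[OF g] A(1) by auto
      then have "t y = a" using t_eq[of y a] a p(2) y(2) by force
      then show "a \<in> t ` g ` A" using y(1) by blast
    qed
  qed
  have finA: "finite A" using A(2) card.infinite by fastforce
  have "t \<notin> Bij \<Omega>"
  proof
    assume "t \<in> Bij \<Omega>"
    then have "t ` \<Omega> = \<Omega>" by (simp add: Bij_def bij_betw_def)
    moreover have "t ` \<Omega> \<subseteq> A" using t_in by (rule image_subsetI)
    ultimately have "\<Omega> \<subseteq> A" by simp
    then have "card \<Omega> \<le> card A" using finA by (rule card_mono[rotated])
    moreover have "card A < card A * card B" using A(2) B(2) by simp
    ultimately show False using prod by simp
  qed
  then obtain s where s: "s \<in> generated_monoid \<Omega> (insert t G)" "card (s ` \<Omega>) = 1"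
    using sync t_PiE by (auto simp: synchronizing_def)
  \<comment> \<open>Quantifying over all translates of \<open>A\<close> makes the property closed
    under composition; for \<open>t\<close> the new translate is \<open>A\<close> itself, with
    \<open>h\<close> the identity.\<close>
  have "\<forall>g\<in>G. \<exists>h\<in>G. s ` g ` A = h ` A"
    using s(1)
  proof (rule generated_monoid_induct)
    show "insert t G \<subseteq> \<Omega> \<rightarrow>\<^sub>E \<Omega>" using t_PiE perm_PiE by auto
    show "\<forall>g\<in>G. \<exists>h\<in>G. (\<lambda>x\<in>\<Omega>. x) ` g ` A = h ` A"
      using perm_compose[OF one_perm] image_compose[OF A(1)] by metis
    have id: "(\<lambda>x\<in>\<Omega>. x) ` A = A" using A(1) by force
    fix f assume "f \<in> insert t G"
    then show "\<forall>g\<in>G. \<exists>h\<in>G. f ` g ` A = h ` A"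
    proof
      assume "f = t"
      then show ?thesis using t_image id one_perm by metis
    next
      assume "f \<in> G"
      then show ?thesis using perm_compose image_compose[OF A(1)] by metis
    qed
  next
    fix f f'
    assume f: "\<forall>g\<in>G. \<exists>h\<in>G. f ` g ` A = h ` A" and f': "\<forall>g\<in>G. \<exists>h\<in>G. f' ` g ` A = h ` A"
    show "\<forall>g\<in>G. \<exists>h\<in>G. compose \<Omega> f f' ` g ` A = h ` A"
    proof
      fix g assume g: "g \<in> G"
      then have "compose \<Omega> f f' ` g ` A = f ` f' ` g ` A"
        using A(1) perm_in by (intro image_compose) auto
      then show "\<exists>h\<in>G. compose \<Omega> f f' ` g ` A = h ` A" using f f' g by metis
    qed
  qed
  \<comment> \<open>Applied to the trivial translate, the invariant puts a set of size
    \<open>card A\<close> inside the image of \<open>s\<close>, so \<open>s\<close> is not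
    constant.\<close>
  then obtain h where h: "h \<in> G" "s ` (\<lambda>x\<in>\<Omega>. x) ` A = h ` A" using one_perm by blast
  have "h ` A \<subseteq> s ` \<Omega>" unfolding h(2)[symmetric] using A(1) by (intro image_mono) auto
  then have "card (h ` A) \<le> card (s ` \<Omega>)" using finite_domain by (intro card_mono) auto
  moreover have "card (h ` A) = card A" using perm_inj_on[OF h(1) A(1)] by (rule card_image)
  ultimately show False using s(2) A(2) by simp
qed

end

section \<open>Translations in affine and diagonal groups\<close>

text \<open>Surjectivity of \<psi> lets elements of the concrete group \<open>H\<close> be pulled
  back to \<open>G\<close>.\<close>

lemma perm_isomorphic_preimage:
  assumes "bij_betw \<phi> \<Omega> \<Delta>"
    and "\<psi> \<in> iso (BijGroup \<Omega>\<lparr>carrier := G\<rparr>) (BijGroup \<Delta>\<lparr>carrier := H\<rparr>)"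
    and "\<forall>g\<in>G. \<forall>x\<in>\<Omega>. \<phi> (g x) = \<psi> g (\<phi> x)"
    and "q \<in> H"
  shows "\<exists>p\<in>G. \<forall>x\<in>\<Omega>. \<phi> (p x) = q (\<phi> x)"
proof -
  have "\<psi> ` G = H" using assms(2) by (auto simp: iso_def bij_betw_def)
  with assms(3,4) show ?thesis by auto
qed

text \<open>Addition is commutative, so the two-sided map for \<open>g\<close> and \<open>h\<close>
  is the single translation by -g + h, which belongs to \<open>H\<close>.\<close>

lemma affine_type_translations:
  assumes "affine_type K V \<Omega> G"
  obtains \<phi> where "group (add_monoid V)" "bij_betw \<phi> \<Omega> (carrier (add_monoid V))"
    and "\<And>g h. \<lbrakk>g \<in> carrier (add_monoid V); h \<in> carrier (add_monoid V)\<rbrakk> \<Longrightarrow>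
      \<exists>p\<in>G. \<forall>x\<in>\<Omega>. \<phi> (p x) = inv\<^bsub>add_monoid V\<^esub> g \<otimes>\<^bsub>add_monoid V\<^esub> \<phi> x \<otimes>\<^bsub>add_monoid V\<^esub> h"
proof -
  interpret vectorspace K V using assms by (simp add: affine_type_def)
  obtain H \<phi> \<psi> where H: "affine_group K V H" and \<phi>: "bij_betw \<phi> \<Omega> (carrier V)"
    and \<psi>: "\<psi> \<in> iso (BijGroup \<Omega>\<lparr>carrier := G\<rparr>) (BijGroup (carrier V)\<lparr>carrier := H\<rparr>)"
      "\<forall>g\<in>G. \<forall>x\<in>\<Omega>. \<phi> (g x) = \<psi> g (\<phi> x)"
    using assms by (auto simp: affine_type_def perm_isomorphic_def)
  show thesis
  proof (rule that[of \<phi>])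
    show "group (add_monoid V)" by (rule M.a_group)
    show "bij_betw \<phi> \<Omega> (carrier (add_monoid V))" using \<phi> by simp
    fix g h assume "g \<in> carrier (add_monoid V)" "h \<in> carrier (add_monoid V)"
    then have gh: "g \<in> carrier V" "h \<in> carrier V" by auto
    then have "\<ominus>\<^bsub>V\<^esub> g \<oplus>\<^bsub>V\<^esub> h \<in> carrier V" by simp
    with H have "affine_map V (\<lambda>x. x) (\<ominus>\<^bsub>V\<^esub> g \<oplus>\<^bsub>V\<^esub> h) \<in> H"
      unfolding affine_group_def by blast
    from perm_isomorphic_preimage[OF \<phi> \<psi> this] obtain p where p: "p \<in> G"
      "\<forall>x\<in>\<Omega>. \<phi> (p x) = affine_map V (\<lambda>x. x) (\<ominus>\<^bsub>V\<^esub> g \<oplus>\<^bsub>V\<^esub> h) (\<phi> x)" by blast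
    moreover have "\<phi> x \<in> carrier V" if "x \<in> \<Omega>" for x
      using \<phi> that by (auto simp: bij_betw_def)
    ultimately show "\<exists>p\<in>G. \<forall>x\<in>\<Omega>.
        \<phi> (p x) = inv\<^bsub>add_monoid V\<^esub> g \<otimes>\<^bsub>add_monoid V\<^esub> \<phi> x \<otimes>\<^bsub>add_monoid V\<^esub> h"
      using gh by (intro bexI[of _ p])
        (auto simp: affine_map_def M.a_ac simp flip: a_inv_def)
  qed
qed

text \<open>The required maps are precisely the elements of \<open>diagonal_socle T\<close>, which
  \<open>H\<close> contains.\<close>

lemma diagonal_type_translations:
  assumes "diagonal_type T \<Omega> G"
  obtains \<phi> where "group T" "bij_betw \<phi> \<Omega> (carrier T)"
    and "\<And>g h. \<lbrakk>g \<in> carrier T; h \<in> carrier T\<rbrakk> \<Longrightarrow>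
      \<exists>p\<in>G. \<forall>x\<in>\<Omega>. \<phi> (p x) = inv\<^bsub>T\<^esub> g \<otimes>\<^bsub>T\<^esub> \<phi> x \<otimes>\<^bsub>T\<^esub> h"
proof -
  obtain H \<phi> \<psi> where H: "diagonal_socle T \<subseteq> H" and \<phi>: "bij_betw \<phi> \<Omega> (carrier T)"
    and \<psi>: "\<psi> \<in> iso (BijGroup \<Omega>\<lparr>carrier := G\<rparr>) (BijGroup (carrier T)\<lparr>carrier := H\<rparr>)"
      "\<forall>g\<in>G. \<forall>x\<in>\<Omega>. \<phi> (g x) = \<psi> g (\<phi> x)"
    using assms by (auto simp: diagonal_type_def perm_isomorphic_def)
  show thesis
  proof (rule that[of \<phi>])
    show "group T"
      using assms by (simp add: diagonal_type_def simple_group_def)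
    show "bij_betw \<phi> \<Omega> (carrier T)" by fact
    fix g h assume "g \<in> carrier T" "h \<in> carrier T"
    then have "(\<lambda>x\<in>carrier T. inv\<^bsub>T\<^esub> g \<otimes>\<^bsub>T\<^esub> x \<otimes>\<^bsub>T\<^esub> h) \<in> H"
      using H by (auto simp: diagonal_socle_def)
    from perm_isomorphic_preimage[OF \<phi> \<psi> this]
    show "\<exists>p\<in>G. \<forall>x\<in>\<Omega>. \<phi> (p x) = inv\<^bsub>T\<^esub> g \<otimes>\<^bsub>T\<^esub> \<phi> x \<otimes>\<^bsub>T\<^esub> h"
      using bij_betwE[OF \<phi>] by simp
  qed
qed

theorem theorem1p6:
  fixes \<Omega> :: "'a set" and G :: "('a \<Rightarrow> 'a) set"
  assumes "finite \<Omega>"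
    and "subgroup G (BijGroup \<Omega>)"
    and "primitive_group \<Omega> G"
    and "(\<exists>(K :: 'k ring) (V :: ('k, 'v) module). affine_type K V \<Omega> G) \<or>
         (\<exists>T :: 't monoid. diagonal_type T \<Omega> G)"
  shows "synchronizing \<Omega> G \<longleftrightarrow> separating \<Omega> G"
proof
  interpret perm_group \<Omega> G using assms(1,2) by (rule perm_group.intro)
  have trans: "transitive_group \<Omega> G" using assms(3) by (simp add: primitive_group_def)
  show "synchronizing \<Omega> G" if "separating \<Omega> G"
    using that by (rule synchronizing_if_separating)
  assume sync: "synchronizing \<Omega> G"
  from assms(4) show "separating \<Omega> G"
  proof (elim disjE exE)
    fix K :: "'k ring" and V :: "('k, 'v) module" assume "affine_type K V \<Omega> G"
    then obtain \<phi> where *: "group (add_monoid V)" "bij_betw \<phi> \<Omega> (carrier (add_monoid V))"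
      "\<And>g h. \<lbrakk>g \<in> carrier (add_monoid V); h \<in> carrier (add_monoid V)\<rbrakk> \<Longrightarrow>
        \<exists>p\<in>G. \<forall>x\<in>\<Omega>. \<phi> (p x) = inv\<^bsub>add_monoid V\<^esub> g \<otimes>\<^bsub>add_monoid V\<^esub> \<phi> x \<otimes>\<^bsub>add_monoid V\<^esub> h"
      using affine_type_translations by blast
    show ?thesis by (rule separating_if_synchronizing[OF trans * sync])
  next
    fix T :: "'t monoid" assume "diagonal_type T \<Omega> G"
    then obtain \<phi> where *: "group T" "bij_betw \<phi> \<Omega> (carrier T)"
      "\<And>g h. \<lbrakk>g \<in> carrier T; h \<in> carrier T\<rbrakk> \<Longrightarrow>
        \<exists>p\<in>G. \<forall>x\<in>\<Omega>. \<phi> (p x) = inv\<^bsub>T\<^esub> g \<otimes>\<^bsub>T\<^esub> \<phi> x \<otimes>\<^bsub>T\<^esub> h"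
      using diagonal_type_translations by blast
    show ?thesis by (rule separating_if_synchronizing[OF trans * sync])
  qed
qed

end
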